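(* Let $n$ be any positive integer. (i) We have $$\det[|j-k|+\delta_{jk}]_{1\le j,k\le n}=\begin{cases}\dfrac{1+(-1)^{(n-1)/2}n}{2}&\text{if } n \text{ is odd},\\[2mm] \dfrac{1+(-1)^{n/2}}{2}&\text{if } n\text{ is even}.\end{cases}$$ (ii) We have $$\det[F_{|j-k|}+\delta_{jk}]_{1\le j,k\le n}=\begin{cases}1&\text{if } n\equiv 0,\pm1\pmod 6,\\ 0&\text{otherwise},\end{cases}$$ where the Fibonacci numbers $F_0,F_1,F_2,\ldots$ are defined by $F_0=0$, $F_1=1$ and $F_{i+1}=F_i+F_{i-1}$ for $i=1,2,3,\ldots$. (iii) We have $$\det\left[\left(\frac{|j-k|}{3}\right)-\delta_{jk}\right]_{1\le j,k\le n}=\begin{cases}1&\text{if } n\equiv 0\pmod 6,\\ -1&\text{if } n\equiv\pm1\pmod 6,\\ 0&\text{otherwise},\end{cases}$$ where $\left(\frac{\cdot}{3}\right)$ denotes the Legendre symbol.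
   Context: $\delta_{jk}$ is the Kronecker delta: it is $1$ if $j=k$ and $0$ otherwise. $\det[a_{jk}]_{1\le j,k\le n}$ is the determinant of the $n\times n$ matrix with $(j,k)$-entry $a_{jk}$. The Legendre symbol $\left(\frac{m}{3}\right)$ equals $0,1,-1$ according as $m\equiv 0,1,2\pmod 3$. *)

theory Defs
  imports
    "Jordan_Normal_Form.Determinant"
    "HOL-Number_Theory.Fib"
    "HOL-Number_Theory.Residues"
begin

definition kronecker_delta :: "int \<Rightarrow> int \<Rightarrow> int" where
  "kronecker_delta j k = (if j = k then 1 else 0)"

text \<open>
  The matrix \<open>[a j k]\<close> with \<open>1 \<le> j, k \<le> n\<close>. Rows and columns of \<^const>\<open>mat\<close> are numbered
  from \<open>0\<close>, hence the shift; integer indices make \<open>\<bar>j - k\<bar>\<close> the true absolute difference.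
\<close>

definition matrix_1n :: "nat \<Rightarrow> (int \<Rightarrow> int \<Rightarrow> 'a) \<Rightarrow> 'a mat" where
  "matrix_1n n a = mat n n (\<lambda>(r, c). a (int r + 1) (int c + 1))"

lemma Legendre_3:
  "Legendre m 3 = (if m mod 3 = 0 then 0 else if m mod 3 = 1 then 1 else -1)"
proof -
  have sq: "y\<^sup>2 mod 3 = 0 \<or> y\<^sup>2 mod 3 = 1" for y :: int
  proof -
    have "y mod 3 = 0 \<or> y mod 3 = 1 \<or> y mod 3 = 2"
      by presburger
    moreover have "y\<^sup>2 mod 3 = (y mod 3)\<^sup>2 mod 3"
      by (simp add: power_mod)
    ultimately show ?thesis
      by auto
  qed
  have "QuadRes 3 m" if "m mod 3 = 1"
    unfolding QuadRes_def cong_def using that by (intro exI[of _ 1]) simp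
  moreover have "m mod 3 = 1" if "QuadRes 3 m" "m mod 3 \<noteq> 0"
    using that sq unfolding QuadRes_def cong_def by metis
  ultimately show ?thesis
    unfolding Legendre_def cong_def by auto
qed

end

theory Submission
  imports Defs
begin

text \<open>
  In all three cases the matrix has entries \<open>u \<bar>j - k\<bar> + e \<delta>\<^sub>j\<^sub>k\<close>, where \<open>e = \<plusminus>1\<close> and
  \<open>u\<close> is the Lucas sequence \<open>u 0 = 0\<close>, \<open>u 1 = 1\<close>, \<open>u (m + 2) = p u (m + 1) + q u m\<close>:
  \<open>(p, q, e)\<close> is \<open>(2, -1, 1)\<close> for the absolute difference, \<open>(1, 1, 1)\<close> for the
  Fibonacci numbers and \<open>(-1, -1, -1)\<close> for the Legendre symbol modulo \<open>3\<close>.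

  Subtract from every row but the last two \<open>p\<close> times the next row and \<open>q\<close> times the one
  after it. The recurrence then annihilates everything to the right of the second
  superdiagonal, and on that diagonal only \<open>-q e\<close> remains, which is a unit. So a vector killed
  by these rows can be computed forwards from its first two components, and it does not depend
  on the size \<open>n\<close> of the matrix except for being cut off at \<open>n\<close>. Using the two kernel vectors
  that start with \<open>(1, 0)\<close> and \<open>(0, 1)\<close> as new first columns leaves a block triangular matrix
  whose determinant is a power of \<open>-q e\<close> times a \<open>2 \<times> 2\<close> determinant, namely that of the
  last two rows applied to the two kernel vectors (\<open>det_banded_by_kernel\<close>).

  The part of a row to the left of the diagonal acts on a kernel vector \<open>x\<close> by the convolution
  \<open>y n = (\<Sum>k<n. u (n - k) * x k)\<close>, which itself obeys the recurrence of \<open>u\<close> with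
  an inhomogeneity \<open>x\<close>. Hence \<open>(x n, x (n + 1), y n, y (n + 1))\<close> moves under a
  fixed linear map, and the \<open>2 \<times> 2\<close> determinant is an expression in two orbits of this map
  (\<open>det_kernel_state\<close>). For the Fibonacci numbers the sixth power of the map is \<open>-1\<close> and for
  the Legendre symbol it is \<open>1\<close>, so both determinants have period \<open>6\<close> and six values decide
  them. For the absolute difference the two orbits advance by a linear drift every
  four steps, which produces the factor \<open>n\<close> in the answer.
\<close>

section \<open>Banded matrices\<close>

lemma det_2x2:
  fixes A :: "'a :: comm_ring_1 mat"
  assumes A: "A \<in> carrier_mat 2 2"
  shows "det A = A $$ (0,0) * A $$ (1,1) - A $$ (0,1) * A $$ (1,0)"
proof -
  have "det A = (\<Sum>j<2. A $$ (0, j) * cofactor A 0 j)"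
    using laplace_expansion_row[OF A, of 0] by simp
  also have "\<dots> = A $$ (0,0) * A $$ (1,1) - A $$ (0,1) * A $$ (1,0)"
    using A unfolding cofactor_def
    by (simp add: numeral_2_eq_2 det_single mat_delete_def)
  finally show ?thesis .
qed

text \<open>
  Replacing the first two unit vectors by \<open>w\<close> and \<open>z\<close> is a unimodular column operation. It
  clears the top left \<open>n \<times> 2\<close> block and leaves a lower triangular \<open>n \<times> n\<close> block with
  diagonal \<open>c\<close> to the right of it. Exchanging the two blocks of columns costs the sign
  \<open>(-1)\<^bsup>2n\<^esup> = 1\<close>.
\<close>

lemma det_banded_by_kernel:
  fixes B :: "'a :: idom mat" and w z :: "nat \<Rightarrow> 'a"
  assumes B: "B \<in> carrier_mat (n + 2) (n + 2)"
    and beyond: "\<And>r k. r < n \<Longrightarrow> k < n + 2 \<Longrightarrow> r + 2 < k \<Longrightarrow> B $$ (r, k) = 0"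
    and edge: "\<And>r. r < n \<Longrightarrow> B $$ (r, r + 2) = c"
    and w: "w 0 = 1" "w 1 = 0" and z: "z 0 = 0" "z 1 = 1"
    and Bw: "\<And>r. r < n \<Longrightarrow> (\<Sum>k<n+2. B $$ (r, k) * w k) = 0"
    and Bz: "\<And>r. r < n \<Longrightarrow> (\<Sum>k<n+2. B $$ (r, k) * z k) = 0"
  shows "det B = c ^ n *
    ((\<Sum>k<n+2. B $$ (n, k) * w k) * (\<Sum>k<n+2. B $$ (n + 1, k) * z k) -
     (\<Sum>k<n+2. B $$ (n, k) * z k) * (\<Sum>k<n+2. B $$ (n + 1, k) * w k))"
proof -
  define P where "P = mat (n + 2) (n + 2) (\<lambda>(r, k).
    if k = 0 then w r else if k = 1 then z r else if r = k then 1 else 0)"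
  have P: "P \<in> carrier_mat (n + 2) (n + 2)" by (simp add: P_def)
  have upper: "P $$ (r, k) = 0" if "r < k" "k < n + 2" for r k
  proof (cases "k = 1")
    case True
    then have "r = 0" using that by simp
    then show ?thesis using that True z by (simp add: P_def)
  next
    case False
    then show ?thesis using that by (simp add: P_def)
  qed
  then have "det P = prod_list (diag_mat P)"
    using upper P by (intro det_lower_triangular)
  moreover have "diag_mat P = map (\<lambda>_. 1) [0..<n+2]"
    unfolding diag_mat_def using w z by (intro map_cong) (auto simp: P_def)
  then have "prod_list (diag_mat P) = 1"
    by (simp add: map_replicate_const)
  ultimately have det_P: "det P = 1" by simp
  have BP: "B * P \<in> carrier_mat (n + 2) (n + 2)" using B P by simp
  have entry: "(B * P) $$ (r, k) = (\<Sum>l<n+2. B $$ (r, l) * P $$ (l, k))"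
    if "r < n + 2" "k < n + 2" for r k
    using that B P by (simp add: scalar_prod_def atLeast0LessThan)
  have entry_w: "(B * P) $$ (r, 0) = (\<Sum>l<n+2. B $$ (r, l) * w l)" if "r < n + 2" for r
    using that by (subst entry) (auto simp: P_def intro: sum.cong)
  have entry_z: "(B * P) $$ (r, 1) = (\<Sum>l<n+2. B $$ (r, l) * z l)" if "r < n + 2" for r
    using that by (subst entry) (auto simp: P_def intro: sum.cong)
  have entry_B: "(B * P) $$ (r, k) = B $$ (r, k)" if "r < n + 2" "k < n + 2" "1 < k" for r k
  proof -
    have "(B * P) $$ (r, k) = (\<Sum>l<n+2. if l = k then B $$ (r, l) else 0)"
      unfolding entry[OF that(1,2)] using that by (intro sum.cong) (auto simp: P_def)
    then show ?thesis using that by (simp del: sum.lessThan_Suc)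
  qed
  \<comment> \<open>The blocks of \<open>B * P\<close> after its first two columns have been moved to the end.\<close>
  define T where "T = mat n n (\<lambda>(r, k). B $$ (r, k + 2))"
  define Q where "Q = mat 2 n (\<lambda>(r, k). B $$ (r + n, k + 2))"
  define R where "R = mat 2 2 (\<lambda>(r, k). (B * P) $$ (r + n, k))"
  have T: "T \<in> carrier_mat n n" by (simp add: T_def)
  have det_T: "det T = c ^ n"
  proof -
    have "det T = prod_list (diag_mat T)"
      by (rule det_lower_triangular[OF _ T]) (simp add: T_def beyond)
    also have "diag_mat T = map (\<lambda>_. c) [0..<n]"
      unfolding diag_mat_def by (intro map_cong) (auto simp: T_def edge[simplified])
    finally show ?thesis by (simp add: map_replicate_const)
  qed
  have "det (B * P) = (-1) ^ (2 * n) *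
      det (mat (n + 2) (n + 2) (\<lambda>(r, k). (B * P) $$ (r, if k < n then k + 2 else k - n)))"
    using det_swap_cols[OF BP] by (simp add: mult.commute)
  also have "mat (n + 2) (n + 2) (\<lambda>(r, k). (B * P) $$ (r, if k < n then k + 2 else k - n)) =
      four_block_mat T (0\<^sub>m n 2) Q R" (is "?L = ?R")
  proof (rule eq_matI)
    fix r k assume "r < dim_row ?R" "k < dim_col ?R"
    then have rk: "r < n + 2" "k < n + 2" by (auto simp: T_def R_def)
    have "(B * P) $$ (r, k - n) = 0" if "r < n" "\<not> k < n"
    proof -
      have "k - n = 0 \<or> k - n = 1" using rk by linarith
      then show ?thesis using that(1) entry_w[of r] entry_z[of r] Bw[of r] Bz[of r] by auto
    qed
    moreover have "(B * P) $$ (r, k + 2) = B $$ (r, k + 2)" if "k < n"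
      using that rk by (intro entry_B) auto
    ultimately show "?L $$ (r, k) = ?R $$ (r, k)"
      using rk by (auto simp: T_def Q_def R_def)
  qed (auto simp: T_def R_def)
  also have "det (four_block_mat T (0\<^sub>m n 2) Q R) = det T * det R"
    by (rule det_four_block_mat_upper_right_zero[OF T]) (auto simp: Q_def R_def)
  also have "det R = (\<Sum>k<n+2. B $$ (n, k) * w k) * (\<Sum>k<n+2. B $$ (n + 1, k) * z k) -
     (\<Sum>k<n+2. B $$ (n, k) * z k) * (\<Sum>k<n+2. B $$ (n + 1, k) * w k)"
    using entry_w[of n] entry_z[of n] entry_w[of "n + 1"] entry_z[of "n + 1"]
    by (subst det_2x2) (simp_all add: R_def del: sum.lessThan_Suc index_mult_mat)
  finally show ?thesis
    using det_mult[OF B P] det_P det_T by simp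
qed


section \<open>Toeplitz matrices of a second order recurrence\<close>

text \<open>
  The orbit \<open>(x n, x (n + 1), y n, y (n + 1))\<close> of a kernel vector \<open>x\<close> with
  \<open>x 0 = a\<close>, \<open>x 1 = b\<close> and of its convolution \<open>y\<close> with \<open>u\<close>. Row \<open>n\<close> of the reduced matrix kills
  \<open>x\<close> exactly if \<open>q e x (n + 2)\<close> is the bracket in the first line of the recursion, and
  \<open>q e\<close> is its own inverse.
\<close>

primrec kernel_state :: "'a::comm_ring_1 \<Rightarrow> 'a \<Rightarrow> 'a \<Rightarrow> 'a \<Rightarrow> 'a \<Rightarrow> nat \<Rightarrow> 'a \<times> 'a \<times> 'a \<times> 'a"
  where
    "kernel_state p q e a b 0 = (a, b, 0, a)"
  | "kernel_state p q e a b (Suc n) = (case kernel_state p q e a b n of (x, x', y, y') \<Rightarrow>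
       (x', q * e * (e * x + (1 - p * e - q) * x' + (1 - q * q) * y - p * (1 + q) * y'),
        y', q * y + p * y' + x'))"

text \<open>
  The \<open>2 \<times> 2\<close> determinant of rows \<open>n\<close> and \<open>n + 1\<close> of the matrix of size \<open>n + 2\<close>, applied
  to the two kernel vectors. Row \<open>n\<close> has one more entry, \<open>u 1 = 1\<close>, to the right of the diagonal.
\<close>

definition border_det :: "'a::comm_ring_1 \<Rightarrow> 'a \<times> 'a \<times> 'a \<times> 'a \<Rightarrow> 'a \<times> 'a \<times> 'a \<times> 'a \<Rightarrow> 'a"
  where "border_det e s t = (case (s, t) of ((x, x', y, y'), (z, z', v, v')) \<Rightarrow>
    (y + e * x + x') * (v' + e * z') - (v + e * z + z') * (y' + e * x'))"

locale recurrent_toeplitz =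
  fixes p q e :: "'a::idom" and u :: "nat \<Rightarrow> 'a"
  assumes u_0: "u 0 = 0" and u_1: "u 1 = 1"
    and u_rec: "u (m + 2) = p * u (m + 1) + q * u m"
    and unit: "(q * e)\<^sup>2 = 1"
begin

definition entry :: "nat \<Rightarrow> nat \<Rightarrow> 'a" where
  "entry r k = u (if r \<le> k then k - r else r - k) + (if r = k then e else 0)"

lemma u_2: "u 2 = p"
  using u_rec[of 0] u_0 u_1 by (simp add: numeral_2_eq_2)

text \<open>To the right of the band, the combination of three rows is an instance of the recurrence of \<open>u\<close>.\<close>

lemma combined_entry_eq_0:
  assumes "r + 2 < k"
  shows "entry r k - p * entry (r + 1) k - q * entry (r + 2) k = 0"
proof -
  have k: "k - r = (k - (r + 2)) + 2" "k - (r + 1) = (k - (r + 2)) + 1"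
    using assms by auto
  have "entry r k = u (k - r)" "entry (r + 1) k = u (k - (r + 1))"
      "entry (r + 2) k = u (k - (r + 2))"
    using assms by (auto simp: entry_def)
  then show ?thesis
    unfolding k u_rec by simp
qed

lemma convolution:
  fixes x y :: "nat \<Rightarrow> 'a"
  assumes "y 0 = 0" "y 1 = x 0" "\<And>j. y (j + 2) = q * y j + p * y (j + 1) + x (j + 1)"
  shows "y n = (\<Sum>k<n. u (n - k) * x k)"
proof (induction n rule: less_induct)
  case (less n)
  consider "n = 0" | "n = 1" | j where "n = j + 2"
    by (metis One_nat_def Suc_1 add.commute add_0 add_Suc not0_implies_Suc)
  then show ?case
  proof cases
    case 3
    have "(\<Sum>k<j. u (j + 2 - k) * x k)
        = (\<Sum>k<j. p * (u (j + 1 - k) * x k) + q * (u (j - k) * x k))"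
    proof (rule sum.cong)
      fix k assume "k \<in> {..<j}"
      then have "j + 2 - k = (j - k) + 2" "j + 1 - k = (j - k) + 1" by auto
      then show "u (j + 2 - k) * x k = p * (u (j + 1 - k) * x k) + q * (u (j - k) * x k)"
        by (simp only: u_rec) (simp add: algebra_simps)
    qed simp
    then have "(\<Sum>k<j. u (j + 2 - k) * x k)
        = p * (\<Sum>k<j. u (j + 1 - k) * x k) + q * (\<Sum>k<j. u (j - k) * x k)"
      by (simp only: sum.distrib sum_distrib_left)
    moreover have "y j = (\<Sum>k<j. u (j - k) * x k)"
      using less[of j] 3 by simp
    moreover have "y (j + 1) = (\<Sum>k<j. u (j + 1 - k) * x k) + x j"
      using less[of "j + 1"] 3 u_1 by simp
    moreover have "(\<Sum>k<n. u (n - k) * x k) =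
        (\<Sum>k<j. u (j + 2 - k) * x k) + u 2 * x j + u 1 * x (j + 1)"
      using 3 by (simp add: numeral_2_eq_2)
    ultimately show ?thesis
      using 3 assms(3)[of j] u_1 u_2 by (simp add: algebra_simps)
  qed (use assms u_1 in auto)
qed

context
  fixes x y :: "nat \<Rightarrow> 'a"
  assumes y0: "y 0 = 0" and y1: "y 1 = x 0"
    and y_rec: "\<And>j. y (j + 2) = q * y j + p * y (j + 1) + x (j + 1)"
    and x_rec: "\<And>j. x (j + 2) =
      q * e * (e * x j + (1 - p * e - q) * x (j + 1) + (1 - q * q) * y j - p * (1 + q) * y (j + 1))"
begin

lemma row_sum_diag: "(\<Sum>k<Suc r. entry r k * x k) = y r + e * x r"
proof -
  have "(\<Sum>k<r. entry r k * x k) = (\<Sum>k<r. u (r - k) * x k)"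
    by (intro sum.cong) (auto simp: entry_def)
  then show ?thesis
    using convolution[of y x r, OF y0 y1 y_rec] by (simp add: entry_def u_0)
qed

lemma row_sum_diag_Suc: "(\<Sum>k<Suc (Suc r). entry r k * x k) = y r + e * x r + x (Suc r)"
  using row_sum_diag[of r] u_1 by (simp add: entry_def)

text \<open>
  Row \<open>r\<close> of the reduced matrix ends in column \<open>r + 2\<close>, so the sum does not depend on \<open>n\<close>, and
  the row sums up to there are expressions in \<open>x\<close> and \<open>y\<close>. The recursion for \<open>x\<close> is chosen to
  make their combination vanish.
\<close>

lemma combined_row_sum:
  assumes "r < n"
  shows "(\<Sum>k<n+2. (entry r k - p * entry (r + 1) k - q * entry (r + 2) k) * x k) = 0"
proof -
  let ?f = "\<lambda>k. (entry r k - p * entry (r + 1) k - q * entry (r + 2) k) * x k"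
  have "(\<Sum>k<n+2. ?f k) = (\<Sum>k<r+3. ?f k)"
    using assms combined_entry_eq_0[of r] by (intro sum.mono_neutral_right) auto
  also have "\<dots> = (\<Sum>k<r+3. entry r k * x k) - p * (\<Sum>k<r+3. entry (r + 1) k * x k)
      - q * (\<Sum>k<r+3. entry (r + 2) k * x k)"
    by (simp only: sum_distrib_left sum_subtractf[symmetric])
      (intro sum.cong refl, simp add: algebra_simps)
  also have "(\<Sum>k<r+3. entry (r + 2) k * x k) = y (r + 2) + e * x (r + 2)"
    using row_sum_diag[of "r + 2"] by (simp only: add_Suc_right[symmetric]) simp
  also have "(\<Sum>k<r+3. entry (r + 1) k * x k) = y (r + 1) + e * x (r + 1) + x (r + 2)"
    using row_sum_diag_Suc[of "r + 1"] by (simp add: eval_nat_numeral del: sum.lessThan_Suc)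
  also have "(\<Sum>k<r+3. entry r k * x k) = y r + e * x r + x (r + 1) + p * x (r + 2)"
  proof -
    have "(\<Sum>k<r+3. entry r k * x k) =
        (\<Sum>k<Suc (Suc r). entry r k * x k) + entry r (r + 2) * x (r + 2)"
      by (simp add: eval_nat_numeral)
    moreover have "entry r (r + 2) = p"
      using u_2 by (simp add: entry_def)
    ultimately show ?thesis
      unfolding row_sum_diag_Suc by simp
  qed
  finally have "(\<Sum>k<n+2. ?f k) =
    (e * x r + (1 - p * e - q) * x (r + 1) + (1 - q * q) * y r - p * (1 + q) * y (r + 1))
     - q * e * x (r + 2)"
    unfolding y_rec by (simp add: algebra_simps)
  also have "q * e * x (r + 2) = (q * e)\<^sup>2 *
      (e * x r + (1 - p * e - q) * x (r + 1) + (1 - q * q) * y r - p * (1 + q) * y (r + 1))"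
    unfolding x_rec power2_eq_square by (simp only: mult.assoc)
  finally show ?thesis
    unfolding unit by simp
qed

end

lemma det_kernel_state:
  "det (mat (n + 2) (n + 2) (\<lambda>(r, k). entry r k)) =
     (- (q * e)) ^ n * border_det e (kernel_state p q e 1 0 n) (kernel_state p q e 0 1 n)"
proof -
  define X where "X = (\<lambda>a b j. fst (kernel_state p q e a b j))"
  define Y where "Y = (\<lambda>a b j. fst (snd (snd (kernel_state p q e a b j))))"
  have state: "kernel_state p q e a b j = (X a b j, X a b (j + 1), Y a b j, Y a b (j + 1))" for a b j
    by (cases "kernel_state p q e a b j") (simp add: X_def Y_def)
  have Y0: "Y a b 0 = 0" and Y1: "Y a b 1 = X a b 0"
    and X0: "X a b 0 = a" and X1: "X a b 1 = b" for a b
    by (simp_all add: X_def Y_def)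
  have Y_rec: "Y a b (j + 2) = q * Y a b j + p * Y a b (j + 1) + X a b (j + 1)"
   and X_rec: "X a b (j + 2) = q * e * (e * X a b j + (1 - p * e - q) * X a b (j + 1) +
      (1 - q * q) * Y a b j - p * (1 + q) * Y a b (j + 1))" for a b j
    using state[of a b "Suc j"] by (simp_all add: state[of a b j])
  \<comment> \<open>Multiplication by \<open>L\<close> from the left performs the row operations.\<close>
  define L where "L = mat (n + 2) (n + 2) (\<lambda>(r, k). if r = k then 1
    else if r < n \<and> k = r + 1 then - p else if r < n \<and> k = r + 2 then - q else 0)"
  define M where "M = mat (n + 2) (n + 2) (\<lambda>(r, k). entry r k)"
  have L: "L \<in> carrier_mat (n + 2) (n + 2)" and M: "M \<in> carrier_mat (n + 2) (n + 2)"
    by (simp_all add: L_def M_def)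
  have "det L = prod_list (diag_mat L)"
    using L by (intro det_upper_triangular) (auto simp: L_def)
  also have "diag_mat L = map (\<lambda>_. 1) [0..<n+2]"
    unfolding diag_mat_def by (intro map_cong) (auto simp: L_def)
  finally have det_L: "det L = 1" by (simp add: map_replicate_const)
  have LM: "L * M \<in> carrier_mat (n + 2) (n + 2)" using L M by simp
  have prod: "(L * M) $$ (r, k) = (\<Sum>l<n+2. L $$ (r, l) * entry l k)"
    if "r < n + 2" "k < n + 2" for r k
    using that L M by (simp add: scalar_prod_def atLeast0LessThan M_def)
  have top: "(L * M) $$ (r, k) = entry r k - p * entry (r + 1) k - q * entry (r + 2) k"
    if "r < n" "k < n + 2" for r k
  proof -
    have r: "r < n + 2" using that by simp
    have "(L * M) $$ (r, k) = (\<Sum>l\<in>{r, r + 1, r + 2}. L $$ (r, l) * entry l k)"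
      unfolding prod[OF r that(2)] using that
      by (intro sum.mono_neutral_right) (auto simp: L_def)
    also have "\<dots> = entry r k - p * entry (r + 1) k - q * entry (r + 2) k"
      using that by (simp add: L_def)
    finally show ?thesis .
  qed
  have bottom: "(L * M) $$ (r, k) = entry r k" if "n \<le> r" "r < n + 2" "k < n + 2" for r k
  proof -
    have "(L * M) $$ (r, k) = (\<Sum>l\<in>{r}. L $$ (r, l) * entry l k)"
      unfolding prod[OF that(2,3)] using that
      by (intro sum.mono_neutral_right) (auto simp: L_def)
    then show ?thesis using that by (simp add: L_def)
  qed
  have kernel: "(\<Sum>k<n+2. (L * M) $$ (r, k) * X a b k) = 0" if "r < n" for r a b
    using combined_row_sum[of "Y a b" "X a b", OF Y0 Y1 Y_rec X_rec that] that by (simp add: top)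
  have last: "(\<Sum>k<n+2. (L * M) $$ (n, k) * X a b k) = Y a b n + e * X a b n + X a b (n + 1)"
   and last': "(\<Sum>k<n+2. (L * M) $$ (n + 1, k) * X a b k) = Y a b (n + 1) + e * X a b (n + 1)" for a b
    using row_sum_diag_Suc[of "Y a b" "X a b", OF Y0 Y1 Y_rec X_rec, of n]
      row_sum_diag[of "Y a b" "X a b", OF Y0 Y1 Y_rec X_rec, of "n + 1"]
    by (simp_all add: bottom)
  have "det (L * M) = (- (q * e)) ^ n *
    ((\<Sum>k<n+2. (L * M) $$ (n, k) * X 1 0 k) * (\<Sum>k<n+2. (L * M) $$ (n + 1, k) * X 0 1 k) -
     (\<Sum>k<n+2. (L * M) $$ (n, k) * X 0 1 k) * (\<Sum>k<n+2. (L * M) $$ (n + 1, k) * X 1 0 k))"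
  proof (rule det_banded_by_kernel[OF LM])
    fix r k assume rk: "r < n" "k < n + 2" "r + 2 < k"
    then show "(L * M) $$ (r, k) = 0"
      using combined_entry_eq_0 by (simp only: top)
  next
    fix r assume "r < n"
    then show "(L * M) $$ (r, r + 2) = - (q * e)"
      using u_2 u_1 u_0 by (simp add: top entry_def)
  qed (use X0 X1 kernel in auto)
  then show ?thesis
    unfolding last last' det_mult[OF L M] det_L
    by (simp add: M_def border_det_def state)
qed

lemma det_matrix_1n:
  "det (matrix_1n (n + 2) (\<lambda>j k. u (nat \<bar>j - k\<bar>) + (if j = k then e else 0))) =
     (- (q * e)) ^ n * border_det e (kernel_state p q e 1 0 n) (kernel_state p q e 0 1 n)"
proof -
  have "matrix_1n (n + 2) (\<lambda>j k. u (nat \<bar>j - k\<bar>) + (if j = k then e else 0)) =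
      mat (n + 2) (n + 2) (\<lambda>(r, k). entry r k)"
    unfolding matrix_1n_def by (intro cong_mat)
      (auto simp: entry_def nat_diff_distrib' abs_if intro!: arg_cong[of _ _ u])
  then show ?thesis using det_kernel_state by simp
qed

end

section \<open>The three determinants\<close>

lemma periodic_mod:
  assumes "\<And>n. f (n + k) = f n"
  shows "f n = f (n mod k :: nat)"
proof -
  have "f (m + k * t) = f m" for m t
    by (induction t) (simp_all add: assms flip: add.assoc add: add.commute[of k])
  from this[of "n mod k" "n div k"] show ?thesis by simp
qed

lemma cong_mod_6:
  "[int n = 0] (mod 6) \<longleftrightarrow> n mod 6 = 0"
  "[int n = 1] (mod 6) \<longleftrightarrow> n mod 6 = 1"
  "[int n = -1] (mod 6) \<longleftrightarrow> n mod 6 = 5"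
  unfolding cong_def by (simp; presburger)+

lemma det_fib:
  "det (matrix_1n (n + 2) (\<lambda>j k. int (fib (nat \<bar>j - k\<bar>)) + kronecker_delta j k)) =
     (if n mod 6 < 3 then 0 else 1)"
proof -
  interpret recurrent_toeplitz 1 1 1 "\<lambda>m. int (fib m)"
    by unfold_locales auto
  define D :: "nat \<Rightarrow> int" where
    "D n = (- 1) ^ n * border_det 1 (kernel_state 1 1 1 1 0 n) (kernel_state 1 1 1 0 1 n)" for n
  \<comment> \<open>Six steps negate every state, and \<open>border_det\<close> is bilinear in the two states.\<close>
  have "D (n + 6) = D n" for n
    unfolding D_def
    by (cases "kernel_state 1 1 1 1 0 n :: int \<times> int \<times> int \<times> int";
        cases "kernel_state 1 1 1 0 1 n :: int \<times> int \<times> int \<times> int")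
      (simp add: numeral_eq_Suc border_det_def algebra_simps)
  then have D_mod: "D n = D (n mod 6)" by (rule periodic_mod)
  define r where "r = n mod 6"
  have "r \<in> {0, 1, 2, 3, 4, 5}" by (auto simp: r_def)
  moreover have "D 0 = 0" "D 1 = 0" "D 2 = 0" "D 3 = 1" "D 4 = 1" "D 5 = 1"
    by (simp_all add: D_def border_det_def eval_nat_numeral)
  ultimately have "D n = (if n mod 6 < 3 then 0 else 1)"
    unfolding D_mod r_def[symmetric] by auto
  then show ?thesis
    using det_matrix_1n[of n] by (simp add: D_def kronecker_delta_def)
qed

lemma det_Legendre:
  "det (matrix_1n (n + 2) (\<lambda>j k. Legendre \<bar>j - k\<bar> 3 - kronecker_delta j k)) =
     (if n mod 6 < 3 then 0 else if n mod 6 = 4 then 1 else -1)"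
proof -
  interpret recurrent_toeplitz "-1" "-1" "-1" "\<lambda>m. Legendre (int m) 3"
  proof unfold_locales
    fix m :: nat
    define r where "r = int m mod 3"
    have r: "r = 0 \<or> r = 1 \<or> r = 2" unfolding r_def by presburger
    have m: "int (m + 1) mod 3 = (r + 1) mod 3" "int (m + 2) mod 3 = (r + 2) mod 3"
      unfolding r_def by presburger+
    show "Legendre (int (m + 2)) 3 = - 1 * Legendre (int (m + 1)) 3 + - 1 * Legendre (int m) 3"
      unfolding Legendre_3 m r_def[symmetric] using r by (elim disjE) simp_all
  qed (simp_all add: Legendre_3)
  define D :: "nat \<Rightarrow> int" where
    "D n = (- 1) ^ n * border_det (-1)
      (kernel_state (-1) (-1) (-1) 1 0 n) (kernel_state (-1) (-1) (-1) 0 1 n)" for n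
  \<comment> \<open>Six steps map every state to itself.\<close>
  have "D (n + 6) = D n" for n
    unfolding D_def
    by (cases "kernel_state (-1) (-1) (-1) 1 0 n :: int \<times> int \<times> int \<times> int";
        cases "kernel_state (-1) (-1) (-1) 0 1 n :: int \<times> int \<times> int \<times> int")
      (simp add: numeral_eq_Suc border_det_def algebra_simps)
  then have D_mod: "D n = D (n mod 6)" by (rule periodic_mod)
  define r where "r = n mod 6"
  have "r \<in> {0, 1, 2, 3, 4, 5}" by (auto simp: r_def)
  moreover have "D 0 = 0" "D 1 = 0" "D 2 = 0" "D 3 = -1" "D 4 = 1" "D 5 = -1"
    by (simp_all add: D_def border_det_def eval_nat_numeral)
  ultimately have "D n = (if n mod 6 < 3 then 0 else if n mod 6 = 4 then 1 else -1)"
    unfolding D_mod r_def[symmetric] by auto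
  moreover have "matrix_1n (n + 2)
      (\<lambda>j k. Legendre (int (nat \<bar>j - k\<bar>)) 3 + (if j = k then - 1 else 0)) =
    matrix_1n (n + 2) (\<lambda>j k. Legendre \<bar>j - k\<bar> 3 - kronecker_delta j k)"
    unfolding matrix_1n_def by (intro cong_mat) (auto simp: kronecker_delta_def)
  ultimately show ?thesis
    using det_matrix_1n[of n] by (simp add: D_def)
qed

text \<open>
  Here the map on states is not of finite order, but after four steps each of the two orbits is
  back at its start up to a shift of the convolution by \<open>2\<close>.
\<close>

lemma kernel_state_abs:
  "kernel_state 2 (-1) 1 1 0 (4 * m) = (1, 0, 2 * int m, 2 * int m + 1)"
  "kernel_state 2 (-1) 1 0 1 (4 * m) = (0, 1, 2 * int m, 2 * int m)"
  by (induction m) (simp_all add: numeral_eq_Suc)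

lemma det_abs:
  "(of_int (det (matrix_1n (n + 2) (\<lambda>j k. \<bar>j - k\<bar> + kronecker_delta j k))) :: rat) =
     (if odd n then (1 + (-1) ^ ((n + 1) div 2) * of_nat (n + 2)) / 2
      else (1 + (-1) ^ ((n + 2) div 2)) / 2)"
proof -
  interpret recurrent_toeplitz 2 "-1" 1 int
    by unfold_locales auto
  define D where "D = det (matrix_1n (n + 2) (\<lambda>j k. \<bar>j - k\<bar> + kronecker_delta j k))"
  define m where "m = n div 4"
  have D: "D = border_det 1 (kernel_state 2 (-1) 1 1 0 n) (kernel_state 2 (-1) 1 0 1 n)"
    using det_matrix_1n[of n] by (simp add: D_def kronecker_delta_def)
  consider "n = 4 * m" | "n = Suc (4 * m)" | "n = Suc (Suc (4 * m))"
    | "n = Suc (Suc (Suc (4 * m)))"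
    unfolding m_def by linarith
  then show ?thesis
    unfolding D_def[symmetric] D
    by cases (simp add: kernel_state_abs border_det_def; simp add: algebra_simps)+
qed

theorem theorem1p1:
  fixes n :: nat
  assumes "n > 0"
  shows
    "(of_int (det (matrix_1n n (\<lambda>j k. \<bar>j - k\<bar> + kronecker_delta j k))) :: rat) =
       (if odd n then (1 + (-1) ^ ((n - 1) div 2) * of_nat n) / 2
        else (1 + (-1) ^ (n div 2)) / 2)
     \<and>
     det (matrix_1n n (\<lambda>j k. int (fib (nat \<bar>j - k\<bar>)) + kronecker_delta j k)) =
       (if [int n = 0] (mod 6) \<or> [int n = 1] (mod 6) \<or> [int n = -1] (mod 6) then 1 else 0)
     \<and>
     det (matrix_1n n (\<lambda>j k. Legendre \<bar>j - k\<bar> 3 - kronecker_delta j k)) =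
       (if [int n = 0] (mod 6) then 1
        else if [int n = 1] (mod 6) \<or> [int n = -1] (mod 6) then -1
        else 0)"
proof (cases "n = 1")
  case True
  have "det (matrix_1n 1 f) = f 1 1" for f :: "int \<Rightarrow> int \<Rightarrow> int"
    by (subst det_single) (simp_all add: matrix_1n_def)
  then show ?thesis
    using True by (simp add: kronecker_delta_def Legendre_3 cong_mod_6[of 1, simplified])
next
  case False
  with assms obtain m where m: "n = m + 2"
    by (metis One_nat_def Suc_1 add.commute add_2_eq_Suc'
        gr0_implies_Suc not0_implies_Suc)
  have "n mod 6 = 0 \<longleftrightarrow> m mod 6 = 4" "n mod 6 = 1 \<longleftrightarrow> m mod 6 = 5" "n mod 6 = 5 \<longleftrightarrow> m mod 6 = 3"
      "m mod 6 < 3 \<longleftrightarrow> \<not> (m mod 6 = 3 \<or> m mod 6 = 4 \<or> m mod 6 = 5)"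
    unfolding m by presburger+
  then show ?thesis
    using det_abs[of m] det_fib[of m] det_Legendre[of m] unfolding cong_mod_6 m by auto
qed

end
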